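(* Let $X_n$ denote the height of a (random weighted) Motzkin walk of length $n$. Let $\delta=P'(1)$ be the drift. Then, as $n\to\infty$: 1. For $\delta<0$, $X_n$ converges in distribution to a geometric distribution: $$X_n\stackrel{d}{\to}\operatorname{Geom}\left(\frac{p_1}{p_{-1}}\right).$$ 2. For $\delta=0$, the standardized random variable converges in distribution to a half-normal distribution: $$\frac{X_n}{\sqrt n}\stackrel{d}{\to}\mathcal{H}\left(\sqrt{\frac{P''(1)}{P(1)}}\right).$$ 3. For $\delta>0$, the standardized random variable converges in distribution to a normal distribution: $$\frac{X_n-\mu n}{\sigma\sqrt n}\stackrel{d}{\to}\mathcal{N}(0,1),\qquad \mu=\frac{\delta}{P(1)},\qquad \sigma^2=1-\frac{p_0}{P(1)}-\left(\frac{\delta}{P(1)}\right)^2.$$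
   Context: A Motzkin walk of length $n$ is a sequence of altitudes $\omega=(\omega_0,\dots,\omega_n)$ with $\omega_0=0$ and $\omega_i-\omega_{i-1}\in\{-1,0,1\}$ (no positivity constraint). The steps $-1,0,1$ carry weights $p_{-1},p_0,p_1>0$; the weight of a walk is the product of the weights of its steps. The jump polynomial is $P(u)=p_{-1}u^{-1}+p_0+p_1u$. A random walk of length $n$ is drawn among all walks of length $n$ with probability proportional to its weight (the total weight is $P(1)^n$). The height of a walk is $\max_{k\in\{0,\dots,n\}}\omega_k$. $\operatorname{Geom}(p)$ is the distribution on $\{0,1,2,\dots\}$ with probabilities $(1-p)^kp$. $\mathcal{H}(\sigma)$ is the half-normal distribution with density $\sqrt{\frac{2}{\pi\sigma^2}}\exp\left(-\frac{x^2}{2\sigma^2}\right)$ on $x\ge 0$. $\mathcal{N}(0,1)$ is the standard normal distribution.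
   Formalization: In item 1 the limit is Geom(1 − p_1/p_{-1}) instead of Geom(p_1/p_{-1}): with Geom(p) having masses (1−p)^k p, the printed parameter is false unless p_1/p_{-1} = 1/2 (e.g. p_{-1}=4, p_0=p_1=1 gives limiting mass 3/4 at 0, not 1/4). *)

theory Defs
  imports "HOL-Probability.Probability"
begin

text \<open>
  A walk of length \<open>n\<close> is the list of its \<open>n + 1\<close> altitudes. The step weights are
  given by a function \<open>p\<close> on the integers, of which only the values at
  \<open>- 1\<close>, \<open>0\<close> and \<open>1\<close> are ever used.
\<close>

definition motzkin_walks :: "nat \<Rightarrow> int list set" where
  "motzkin_walks n =
     {\<omega>. length \<omega> = n + 1 \<and> \<omega> ! 0 = 0 \<and> (\<forall>i\<in>{1..n}. \<omega> ! i - \<omega> ! (i - 1) \<in> {-1, 0, 1})}"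

definition walk_weight :: "(int \<Rightarrow> real) \<Rightarrow> int list \<Rightarrow> real" where
  "walk_weight p \<omega> = (\<Prod>i\<in>{1..<length \<omega>}. p (\<omega> ! i - \<omega> ! (i - 1)))"

definition height :: "int list \<Rightarrow> int" where
  "height \<omega> = Max (set \<omega>)"

definition jump_poly :: "(int \<Rightarrow> real) \<Rightarrow> real \<Rightarrow> real" where
  "jump_poly p u = p (-1) * inverse u + p 0 + p 1 * u"

definition drift :: "(int \<Rightarrow> real) \<Rightarrow> real" where
  "drift p = deriv (jump_poly p) 1"

definition walk_measure :: "(int \<Rightarrow> real) \<Rightarrow> nat \<Rightarrow> int list measure" where
  "walk_measure p n = point_measure (motzkin_walks n)
     (\<lambda>\<omega>. ennreal (walk_weight p \<omega> / (\<Sum>\<omega>'\<in>motzkin_walks n. walk_weight p \<omega>')))"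

definition half_normal_distribution :: "real \<Rightarrow> real measure" where
  "half_normal_distribution \<sigma> = density lborel
     (\<lambda>x. ennreal (if 0 \<le> x then sqrt (2 / (pi * \<sigma>\<^sup>2)) * exp (- x\<^sup>2 / (2 * \<sigma>\<^sup>2)) else 0))"

text \<open>
  The parameter is the success probability: the mass at \<open>k\<close> is \<open>(1 - q)^k * q\<close>.
  For negative drift, with \<open>r = p 1 / p (- 1)\<close>, the probability that the height
  is at least \<open>k\<close> tends to \<open>r^k\<close>, so the limiting height has mass \<open>(1 - r) * r^k\<close> at \<open>k\<close>;
  in this parametrisation the limit law is therefore that of parameter \<open>1 - r\<close>.
\<close>

definition geometric_distribution :: "real \<Rightarrow> real measure" where
  "geometric_distribution q = distr (measure_pmf (geometric_pmf q)) borel real"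

lemma motzkin_walks_0: "motzkin_walks 0 = {[0]}"
  by (auto simp: motzkin_walks_def length_Suc_conv)

lemma motzkin_walks_Suc:
  "motzkin_walks (Suc n) = (\<lambda>(\<omega>, s). \<omega> @ [\<omega> ! n + s]) ` (motzkin_walks n \<times> {-1, 0, 1})"
proof (intro equalityI subsetI)
  fix w assume w: "w \<in> motzkin_walks (Suc n)"
  define v where "v = take (n + 1) w"
  define s where "s = w ! (n + 1) - w ! n"
  have len: "length w = n + 2" using w by (simp add: motzkin_walks_def)
  have st: "w ! i - w ! (i - 1) \<in> {-1, 0, 1}" if "i \<in> {1..Suc n}" for i
    using w that by (auto simp: motzkin_walks_def)
  have nth: "v ! i = w ! i" if "i \<le> n" for i using that by (simp add: v_def)
  have "v \<in> motzkin_walks n"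
    unfolding motzkin_walks_def
  proof (intro CollectI conjI ballI)
    show "length v = n + 1" using len by (simp add: v_def)
    show "v ! 0 = 0" using w nth by (simp add: motzkin_walks_def)
    fix i assume i: "i \<in> {1..n}"
    show "v ! i - v ! (i - 1) \<in> {-1, 0, 1}"
    proof -
      have "i \<le> n" "i - 1 \<le> n" "i \<in> {1..Suc n}" using i by auto
      then show ?thesis using st[of i] nth[of i] nth[of "i - 1"] by simp
    qed
  qed
  moreover have "s \<in> {-1, 0, 1}" using st[of "n + 1"] by (auto simp: s_def)
  moreover have "w = v @ [v ! n + s]"
    using take_Suc_conv_app_nth[of "n + 1" w] len nth[of n] by (simp add: v_def s_def)
  ultimately show "w \<in> (\<lambda>(\<omega>, s). \<omega> @ [\<omega> ! n + s]) ` (motzkin_walks n \<times> {-1, 0, 1})"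
    by force
next
  fix w assume "w \<in> (\<lambda>(\<omega>, s). \<omega> @ [\<omega> ! n + s]) ` (motzkin_walks n \<times> {-1, 0, 1})"
  then obtain v s where v: "v \<in> motzkin_walks n" and s: "s \<in> {-1, 0, 1}"
    and w: "w = v @ [v ! n + s]" by auto
  have len: "length v = n + 1" using v by (simp add: motzkin_walks_def)
  show "w \<in> motzkin_walks (Suc n)"
    unfolding motzkin_walks_def
  proof (intro CollectI conjI ballI)
    show "length w = Suc n + 1" using len by (simp add: w)
    show "w ! 0 = 0" using v len by (simp add: w nth_append motzkin_walks_def)
    fix i assume i: "i \<in> {1..Suc n}"
    show "w ! i - w ! (i - 1) \<in> {-1, 0, 1}"
    proof (cases "i = Suc n")
      case True
      then show ?thesis using s len by (simp add: w nth_append)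
    next
      case False
      then have "i \<in> {1..n}" using i by auto
      moreover have "w ! i = v ! i" "w ! (i - 1) = v ! (i - 1)"
        using calculation len by (auto simp: w nth_append)
      ultimately show ?thesis using v by (auto simp: motzkin_walks_def)
    qed
  qed
qed

lemma finite_motzkin_walks: "finite (motzkin_walks n)"
  by (induction n) (auto simp: motzkin_walks_0 motzkin_walks_Suc)

lemma walk_weight_snoc:
  assumes "v \<in> motzkin_walks n"
  shows "walk_weight p (v @ [v ! n + s]) = walk_weight p v * p s"
proof -
  have len: "length v = n + 1" using assms by (simp add: motzkin_walks_def)
  have "walk_weight p (v @ [v ! n + s])
    = (\<Prod>i\<in>{1..<Suc (n + 1)}. p ((v @ [v ! n + s]) ! i - (v @ [v ! n + s]) ! (i - 1)))"
    using len by (simp add: walk_weight_def)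
  also have "\<dots> = (\<Prod>i\<in>{1..<n + 1}. p ((v @ [v ! n + s]) ! i - (v @ [v ! n + s]) ! (i - 1))) * p s"
    using len by (subst prod.atLeastLessThan_Suc) (auto simp: nth_append)
  also have "(\<Prod>i\<in>{1..<n + 1}. p ((v @ [v ! n + s]) ! i - (v @ [v ! n + s]) ! (i - 1)))
    = walk_weight p v"
    unfolding walk_weight_def len using len by (intro prod.cong) (auto simp: nth_append)
  finally show ?thesis .
qed

lemma total_walk_weight: "(\<Sum>\<omega>\<in>motzkin_walks n. walk_weight p \<omega>) = jump_poly p 1 ^ n"
proof (induction n)
  case 0
  show ?case by (simp add: motzkin_walks_0 walk_weight_def)
next
  case (Suc n)
  have inj: "inj_on (\<lambda>(\<omega>, s). \<omega> @ [\<omega> ! n + s]) (motzkin_walks n \<times> {-1, 0, 1})"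
    by (auto simp: inj_on_def)
  have "(\<Sum>\<omega>\<in>motzkin_walks (Suc n). walk_weight p \<omega>)
    = (\<Sum>(\<omega>, s)\<in>motzkin_walks n \<times> {-1, 0, 1}. walk_weight p (\<omega> @ [\<omega> ! n + s]))"
    unfolding motzkin_walks_Suc by (subst sum.reindex[OF inj]) (simp add: case_prod_unfold)
  also have "\<dots> = (\<Sum>(\<omega>, s)\<in>motzkin_walks n \<times> {-1, 0, 1}. walk_weight p \<omega> * p s)"
    by (intro sum.cong refl) (simp add: walk_weight_snoc case_prod_unfold mem_Times_iff)
  also have "\<dots> = (\<Sum>\<omega>\<in>motzkin_walks n. walk_weight p \<omega>) * (\<Sum>s\<in>{-1, 0, 1}. p s)"
    by (simp only: sum_product sum.cartesian_product)
  also have "(\<Sum>s\<in>{-1, 0, 1}. p s) = jump_poly p 1"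
    by (simp add: jump_poly_def)
  finally show ?case using Suc.IH by simp
qed

lemma prob_space_walk_measure:
  assumes "p (-1) > 0" "p 0 > 0" "p 1 > 0"
  shows "prob_space (walk_measure p n)"
proof -
  have P: "jump_poly p 1 ^ n > 0" using assms by (simp add: jump_poly_def)
  have nn: "walk_weight p \<omega> \<ge> 0" if \<omega>: "\<omega> \<in> motzkin_walks n" for \<omega>
    unfolding walk_weight_def
  proof (intro prod_nonneg ballI)
    fix i assume "i \<in> {1..<length \<omega>}"
    then have "\<omega> ! i - \<omega> ! (i - 1) \<in> {-1, 0, 1}" using \<omega> by (auto simp: motzkin_walks_def)
    then show "0 \<le> p (\<omega> ! i - \<omega> ! (i - 1))" using assms by auto
  qed
  show ?thesis
    unfolding walk_measure_def total_walk_weight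
  proof (rule prob_space_point_measure)
    have "(\<Sum>s\<in>motzkin_walks n. ennreal (walk_weight p s / jump_poly p 1 ^ n))
      = ennreal (\<Sum>s\<in>motzkin_walks n. walk_weight p s / jump_poly p 1 ^ n)"
      using nn P by (intro sum_ennreal) (auto intro!: divide_nonneg_pos)
    also have "(\<Sum>s\<in>motzkin_walks n. walk_weight p s / jump_poly p 1 ^ n) = 1"
      using P by (simp only: total_walk_weight less_imp_neq[symmetric] divide_self_if if_False
          flip: sum_divide_distrib)
    finally show "(\<Sum>s\<in>motzkin_walks n. ennreal (walk_weight p s / jump_poly p 1 ^ n)) = 1"
      by simp
  qed (auto simp: finite_motzkin_walks)
qed

end

theory Submission
  imports Defs "HOL-Real_Asymp.Real_Asymp"
begin

text \<open>
  Write \<open>S\<close> for the final altitude and \<open>M\<close> for the height of a walk of length \<open>n\<close>, and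
  \<open>r = p 1 / p (-1)\<close> for the ratio of the weights of an up step and a down step. The
  whole theorem rests on an exact formula (\<open>height_tail\<close>) for every integer \<open>k \<ge> 0\<close>,
    \<open>P (M \<ge> k) = P (S > k) + r^k P (S \<le> -k)\<close>.
  It is the reflection principle for weighted walks: a walk that reaches \<open>k\<close> either ends above
  \<open>k\<close>, or, reflected at level \<open>k\<close> after its first visit there, ends at or above \<open>k\<close>, and \<open>r\<close>
  accounts for exchanging the weights of the two kinds of steps. Reading it as a statement
  about functions of \<open>k\<close> avoids any bijection: conditioning on the first step, both sides
  satisfy the same recursion in \<open>n\<close> for \<open>k \<ge> 1\<close>, and both equal 1 at \<open>k = 0\<close>.

  The formula reduces the height to the final altitude, which is a sum of independent steps.
  The drift has the sign of \<open>r - 1\<close>, and the three regimes differ in the fate of the second term.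

  If \<open>r < 1\<close>, then \<open>S\<close> tends to \<open>-\<infinity>\<close> in probability, by an exponential moment bound
  (\<open>prob_last_le_tendsto_1\<close>). For fixed \<open>k\<close> only \<open>r^k\<close> survives, which is a geometric tail.

  If \<open>r = 1\<close>, the central limit theorem for \<open>S\<close> (\<open>central_limit_last\<close>) gives, on the scale
  of the standard deviation, the limit \<open>\<Phi> x - \<Phi> (-x)\<close> for the distribution function of \<open>M\<close>, where
  \<open>\<Phi>\<close> is that of the standard normal law. This is the half-normal distribution function
  (\<open>cdf_half_normal\<close>).

  If \<open>r > 1\<close>, the relevant \<open>k\<close> is of order \<open>n\<close>, so \<open>r^k\<close> is exponentially large and
  \<open>P (S \<le> -k)\<close> exponentially small. A change of measure (\<open>reflect_last\<close>) turns the product into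
  the expectation of \<open>r^(k - S)\<close> over \<open>S \<ge> k\<close>. It is negligible, since \<open>S\<close> is unlikely to lie in
  a window just above \<open>k\<close> that is short on the scale \<open>sqrt n\<close>, and beyond a long window the integrand
  is small (\<open>reflected_tail_bound\<close>). Hence \<open>M\<close> has the Gaussian limit of \<open>S\<close>.
\<close>

section \<open>Prepending a step to a walk\<close>

text \<open>
  The height is compatible with decomposing a walk at its first step, as the remaining walk
  is again a Motzkin walk, only shifted. Decomposing at the last step would
  involve the joint law of height and final altitude.
\<close>

lemma motzkin_walks_Suc_Cons:
  "motzkin_walks (Suc n) = (\<lambda>(s, \<omega>). 0 # map ((+) s) \<omega>) ` ({-1, 0, 1} \<times> motzkin_walks n)"
proof (induction n)
  case 0
  show ?case
    by (auto simp: motzkin_walks_0 motzkin_walks_Suc)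
next
  case (Suc n)
  have len: "length \<omega> = Suc n" if "\<omega> \<in> motzkin_walks n" for \<omega>
    using that by (simp add: motzkin_walks_def)
  have image_Times: "F ` (G ` A \<times> B) = (\<lambda>(a, b). F (G a, b)) ` (A \<times> B)"
    for F :: "int list \<times> int \<Rightarrow> int list" and G :: "int \<times> int list \<Rightarrow> int list" and A B
    by force
  have Times_image: "F ` (A \<times> G ` B) = (\<lambda>(a, b). F (a, G b)) ` (A \<times> B)"
    for F :: "int \<times> int list \<Rightarrow> int list" and G :: "int list \<times> int \<Rightarrow> int list" and A B
    by force
  have "motzkin_walks (Suc (Suc n)) =
    (\<lambda>((s, \<omega>), t). 0 # map ((+) s) \<omega> @ [s + (\<omega> ! n + t)]) ` (({-1, 0, 1} \<times> motzkin_walks n) \<times> {-1, 0, 1})"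
    unfolding motzkin_walks_Suc[of "Suc n"] Suc.IH
    unfolding image_Times by (intro image_cong) (auto simp: len)
  also have "\<dots> = (\<lambda>(s, \<omega>). 0 # map ((+) s) \<omega>) ` ({-1, 0, 1} \<times> motzkin_walks (Suc n))"
    unfolding motzkin_walks_Suc[of n] Times_image by (force simp: len nth_append image_iff)
  finally show ?case .
qed

lemma walk_weight_Cons:
  assumes "\<omega> \<in> motzkin_walks n"
  shows "walk_weight p (0 # map ((+) s) \<omega>) = p s * walk_weight p \<omega>"
proof -
  have len: "length \<omega> = Suc n" and hd: "\<omega> ! 0 = 0"
    using assms by (auto simp: motzkin_walks_def)
  let ?v = "0 # map ((+) s) \<omega>"
  have "walk_weight p ?v = (\<Prod>i\<in>{Suc 0..<Suc (Suc n)}. p (?v ! i - ?v ! (i - 1)))"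
    using len by (simp add: walk_weight_def)
  also have "\<dots> = (\<Prod>i\<in>{0..<Suc n}. p (?v ! Suc i - ?v ! i))"
    by (subst prod.shift_bounds_Suc_ivl) simp
  also have "\<dots> = p s * (\<Prod>i\<in>{1..<Suc n}. p (?v ! Suc i - ?v ! i))"
    using len hd by (subst prod.atLeast_Suc_lessThan) auto
  also have "(\<Prod>i\<in>{1..<Suc n}. p (?v ! Suc i - ?v ! i)) = walk_weight p \<omega>"
    unfolding walk_weight_def len
  proof (rule prod.cong)
    fix i assume "i \<in> {1..<Suc n}"
    then show "p (?v ! Suc i - ?v ! i) = p (\<omega> ! i - \<omega> ! (i - 1))"
      using len by (cases i) auto
  qed simp
  finally show ?thesis .
qed

lemma walk_not_Nil: "\<omega> \<in> motzkin_walks n \<Longrightarrow> \<omega> \<noteq> []"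
  by (auto simp: motzkin_walks_def)

lemma height_Cons:
  assumes "\<omega> \<noteq> []"
  shows "height (0 # map ((+) s) \<omega>) = max 0 (s + height \<omega>)"
proof -
  have "Max ((+) s ` set \<omega>) = s + Max (set \<omega>)"
    using assms by (intro mono_Max_commute[symmetric]) (auto intro: monoI)
  then show ?thesis
    using assms by (simp add: height_def)
qed

lemma height_nonneg: "\<omega> \<in> motzkin_walks n \<Longrightarrow> 0 \<le> height \<omega>"
  using nth_mem[of 0 \<omega>] by (auto simp: height_def motzkin_walks_def intro!: Max_ge)

section \<open>Expectations over weighted walks\<close>

locale motzkin_weights =
  fixes p :: "int \<Rightarrow> real"
  assumes pos: "0 < p (-1)" "0 < p 0" "0 < p 1"
begin

abbreviation W :: "nat \<Rightarrow> int list measure" where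
  "W n \<equiv> walk_measure p n"

definition step_prob :: "int \<Rightarrow> real" where
  "step_prob s = p s / jump_poly p 1"

definition r :: real where
  "r = p 1 / p (-1)"

lemma jump_poly_1: "jump_poly p 1 = p (-1) + p 0 + p 1"
  by (simp add: jump_poly_def)

lemma jump_poly_1_pos: "0 < jump_poly p 1"
  using pos by (simp add: jump_poly_1)

lemma step_prob_pos: "0 < step_prob (-1)" "0 < step_prob 0" "0 < step_prob 1"
  using pos jump_poly_1_pos by (simp_all add: step_prob_def)

lemma step_prob_sum: "step_prob (-1) + step_prob 0 + step_prob 1 = 1"
  using jump_poly_1_pos by (simp add: step_prob_def jump_poly_1 flip: add_divide_distrib)

lemma r_pos: "0 < r"
  using pos by (simp add: r_def)

lemma step_prob_mult_r: "step_prob (-1) * r = step_prob 1"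
  using pos by (simp add: step_prob_def r_def)

lemma walk_weight_nonneg:
  assumes "\<omega> \<in> motzkin_walks n"
  shows "0 \<le> walk_weight p \<omega>"
  unfolding walk_weight_def
proof (intro prod_nonneg ballI)
  fix i assume "i \<in> {1..<length \<omega>}"
  then have "\<omega> ! i - \<omega> ! (i - 1) \<in> {-1, 0, 1}"
    using assms by (auto simp: motzkin_walks_def)
  then show "0 \<le> p (\<omega> ! i - \<omega> ! (i - 1))"
    using pos by auto
qed

lemma space_W: "space (W n) = motzkin_walks n"
  by (simp add: walk_measure_def space_point_measure)

lemma measurable_W [simp]: "f \<in> W n \<rightarrow>\<^sub>M N \<longleftrightarrow> f \<in> motzkin_walks n \<rightarrow> space N"
  by (simp add: walk_measure_def)

lemma prob_space_W: "prob_space (W n)"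
  using pos by (rule prob_space_walk_measure)

text \<open>
  All probabilities below are written as integrals of \<open>of_bool\<close> conditions. Being finite
  weighted sums, they need no side conditions, and a single recursion in the length of the walk,
  valid for values in any Banach space, serves events, moments and characteristic functions alike.
\<close>

lemma integral_W:
  fixes f :: "int list \<Rightarrow> 'b::{banach, second_countable_topology}"
  shows "integral\<^sup>L (W n) f = (\<Sum>\<omega>\<in>motzkin_walks n. (walk_weight p \<omega> / jump_poly p 1 ^ n) *\<^sub>R f \<omega>)"
  unfolding walk_measure_def total_walk_weight
  using jump_poly_1_pos
  by (subst lebesgue_integral_point_measure_finite)
     (auto simp: finite_motzkin_walks walk_weight_nonneg intro!: divide_nonneg_pos)

lemma integrable_W [simp]:
  fixes f :: "int list \<Rightarrow> 'b::{banach, second_countable_topology}"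
  shows "integrable (W n) f"
  unfolding walk_measure_def by (rule integrable_point_measure_finite[OF finite_motzkin_walks])

lemma integral_W_0:
  fixes f :: "int list \<Rightarrow> 'b::{banach, second_countable_topology}"
  shows "integral\<^sup>L (W 0) f = f [0]"
  by (simp add: integral_W motzkin_walks_0 walk_weight_def)

lemma integral_W_cong:
  fixes f :: "int list \<Rightarrow> 'b::{banach, second_countable_topology}"
  assumes "\<And>\<omega>. \<omega> \<in> motzkin_walks n \<Longrightarrow> f \<omega> = g \<omega>"
  shows "integral\<^sup>L (W n) f = integral\<^sup>L (W n) g"
  using assms by (simp add: integral_W)

lemma integral_W_Suc:
  fixes f :: "int list \<Rightarrow> 'b::{banach, second_countable_topology}"
  shows "integral\<^sup>L (W (Suc n)) f =
    (\<Sum>s\<in>{-1, 0, 1}. step_prob s *\<^sub>R (LINT \<omega>|W n. f (0 # map ((+) s) \<omega>)))"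
proof -
  let ?P = "jump_poly p 1"
  have inj: "inj_on (\<lambda>(s, \<omega>). 0 # map ((+) s) \<omega>) ({-1, 0, 1 :: int} \<times> motzkin_walks n)"
  proof (rule inj_onI, clarsimp simp del: insert_iff)
    fix s t :: int and v w
    assume vw: "v \<in> motzkin_walks n" "w \<in> motzkin_walks n" and eq: "map ((+) s) v = map ((+) t) w"
    have "map ((+) s) v ! 0 = map ((+) t) w ! 0"
      using eq by simp
    then have "s = t"
      using vw by (simp add: motzkin_walks_def)
    moreover from this have "v = w"
      using eq by (auto simp: inj_map_eq_map)
    ultimately show "s = t \<and> v = w" ..
  qed
  have "integral\<^sup>L (W (Suc n)) f = (\<Sum>(s, \<omega>)\<in>{-1, 0, 1} \<times> motzkin_walks n.
      (walk_weight p (0 # map ((+) s) \<omega>) / ?P ^ Suc n) *\<^sub>R f (0 # map ((+) s) \<omega>))"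
    unfolding integral_W motzkin_walks_Suc_Cons
    by (subst sum.reindex[OF inj]) (simp add: case_prod_unfold)
  also have "\<dots> = (\<Sum>s\<in>{-1, 0, 1}. \<Sum>\<omega>\<in>motzkin_walks n.
      step_prob s *\<^sub>R (walk_weight p \<omega> / ?P ^ n) *\<^sub>R f (0 # map ((+) s) \<omega>))"
    by (subst sum.cartesian_product[symmetric], intro sum.cong refl)
       (simp add: walk_weight_Cons step_prob_def)
  also have "\<dots> = (\<Sum>s\<in>{-1, 0, 1}. step_prob s *\<^sub>R (LINT \<omega>|W n. f (0 # map ((+) s) \<omega>)))"
    by (simp only: integral_W scaleR_sum_right)
  finally show ?thesis .
qed

lemma cdf_distr_W:
  "cdf (distr (W n) borel f) x = (LINT \<omega>|W n. of_bool (f \<omega> \<le> x))"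
proof -
  interpret prob_space "W n" by (rule prob_space_W)
  have "cdf (distr (W n) borel f) x = prob {\<omega> \<in> space (W n). f \<omega> \<le> x}"
    unfolding cdf_def by (subst measure_distr) (auto intro!: arg_cong[where f = prob])
  also have "\<dots> = (LINT \<omega>|W n. indicator {\<omega> \<in> space (W n). f \<omega> \<le> x} \<omega>)"
    by (auto intro!: arg_cong[where f = prob])
  also have "\<dots> = (LINT \<omega>|W n. of_bool (f \<omega> \<le> x))"
    by (rule integral_W_cong) (simp add: indicator_def space_W)
  finally show ?thesis .
qed

lemma integral_last_Suc:
  fixes f :: "int \<Rightarrow> 'b::{banach, second_countable_topology}"
  shows "(LINT \<omega>|W (Suc n). f (last \<omega>)) =
    (\<Sum>s\<in>{-1, 0, 1}. step_prob s *\<^sub>R (LINT \<omega>|W n. f (s + last \<omega>)))"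
  unfolding integral_W_Suc
  by (intro sum.cong refl arg_cong[where f = "(*\<^sub>R) _"] integral_W_cong)
     (simp add: last_map walk_not_Nil)

section \<open>The height in terms of the final altitude\<close>

text \<open>
  Conditioning on the first step \<open>s\<close> replaces \<open>k\<close> by \<open>k - s\<close>, which stays nonnegative if
  \<open>k \<ge> 1\<close>. In the second term on the right this shifts the condition on \<open>last\<close> by \<open>-s\<close> instead
  of \<open>s\<close>, and the factor \<open>r powi (k - s)\<close> repairs the mismatch because
  \<open>step_prob (-1) * r = step_prob 1\<close>. At \<open>k = 0\<close> the two events on the right partition the space.
\<close>

lemma height_tail:
  assumes "0 \<le> k"
  shows "(LINT \<omega>|W n. of_bool (k \<le> height \<omega>)) =
    (LINT \<omega>|W n. of_bool (k < last \<omega>)) + r powi k * (LINT \<omega>|W n. of_bool (last \<omega> \<le> - k))"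
  using assms
proof (induction n arbitrary: k)
  case 0
  then show ?case
    by (auto simp: integral_W_0 height_def)
next
  case (Suc n)
  interpret prob_space "W (Suc n)" by (rule prob_space_W)
  show ?case
  proof (cases "k = 0")
    case True
    have "(LINT \<omega>|W (Suc n). (of_bool (0 \<le> height \<omega>) :: real)) = (LINT \<omega>|W (Suc n). 1)"
      by (rule integral_W_cong) (simp add: height_nonneg)
    also have "\<dots> = (LINT \<omega>|W (Suc n). of_bool (0 < last \<omega>) + of_bool (last \<omega> \<le> 0))"
      by (rule integral_W_cong) auto
    also have "\<dots> = (LINT \<omega>|W (Suc n). of_bool (0 < last \<omega>)) + (LINT \<omega>|W (Suc n). of_bool (last \<omega> \<le> 0))"
      by simp
    finally show ?thesis
      using True by simp
  next
    case False
    with Suc.prems have k: "1 \<le> k" by simp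
    have "(LINT \<omega>|W (Suc n). (of_bool (k \<le> height \<omega>) :: real)) =
      (\<Sum>s\<in>{-1, 0, 1}. step_prob s * (LINT \<omega>|W n. of_bool (k - s \<le> height \<omega>)))"
      unfolding integral_W_Suc real_scaleR_def
    proof (intro sum.cong refl arg_cong[where f = "(*) _"] integral_W_cong)
      fix s \<omega> assume "\<omega> \<in> motzkin_walks n"
      then show "(of_bool (k \<le> height (0 # map ((+) s) \<omega>)) :: real) = of_bool (k - s \<le> height \<omega>)"
        using k by (auto simp: height_Cons walk_not_Nil)
    qed
    also have "\<dots> = (\<Sum>s\<in>{-1, 0, 1}. step_prob s * ((LINT \<omega>|W n. of_bool (k - s < last \<omega>)) +
        r powi (k - s) * (LINT \<omega>|W n. of_bool (last \<omega> \<le> - (k - s)))))"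
      using k by (intro sum.cong refl arg_cong[where f = "(*) _"] Suc.IH) auto
    also have "\<dots> = (\<Sum>s\<in>{-1, 0, 1}. step_prob s * (LINT \<omega>|W n. of_bool (k < s + last \<omega>))) +
        (\<Sum>s\<in>{-1, 0, 1}. (step_prob s * r powi (k - s)) * (LINT \<omega>|W n. of_bool (last \<omega> \<le> - (k - s))))"
      by (simp add: algebra_simps)
    also have "(\<Sum>s\<in>{-1, 0, 1}. (step_prob s * r powi (k - s)) * (LINT \<omega>|W n. of_bool (last \<omega> \<le> - (k - s)))) =
        r powi k * (\<Sum>s\<in>{-1, 0, 1}. step_prob s * (LINT \<omega>|W n. of_bool (s + last \<omega> \<le> - k)))"
    proof -
      have "step_prob 1 * r powi (k - 1) = r powi k * step_prob (-1)" "step_prob (-1) * r powi (k + 1) = r powi k * step_prob 1"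
        using r_pos by (simp_all add: power_int_diff power_int_add step_prob_mult_r[symmetric])
      moreover have "(LINT \<omega>|W n. of_bool (last \<omega> \<le> - (k - s))) =
        (LINT \<omega>|W n. (of_bool (- s + last \<omega> \<le> - k) :: real))" for s
        by (rule integral_W_cong) auto
      ultimately show ?thesis
        by (simp add: distrib_left add_ac mult.assoc[symmetric])
    qed
    finally show ?thesis
      by (simp add: integral_last_Suc[where f = "\<lambda>x. of_bool (k < x)"] integral_last_Suc[where f = "\<lambda>x. of_bool (x \<le> - k)"])
  qed
qed

text \<open>
  Flipping all steps of a walk multiplies its weight by \<open>r\<close> to the power minus its final
  altitude: \<open>-last\<close> is distributed as \<open>last\<close> tilted by \<open>r powi (- last)\<close>.
\<close>

lemma reflect_last:
  fixes f :: "int \<Rightarrow> real"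
  shows "(LINT \<omega>|W n. r powi (- last \<omega>) * f (last \<omega>)) = (LINT \<omega>|W n. f (- last \<omega>))"
proof (induction n arbitrary: f)
  case 0
  show ?case by (simp add: integral_W_0)
next
  case (Suc n)
  have "(LINT \<omega>|W n. r powi (- (s + last \<omega>)) * f (s + last \<omega>)) =
      r powi (- s) * (LINT \<omega>|W n. f (s - last \<omega>))" for s
    unfolding Suc.IH[of "\<lambda>x. f (s + x)", simplified, symmetric] integral_mult_right_zero[symmetric]
    using r_pos by (intro integral_W_cong) (simp add: power_int_add power_int_diff power_int_minus field_simps)
  moreover have "step_prob 1 * r powi (-1) = step_prob (-1)"
    using r_pos by (simp add: power_int_minus step_prob_mult_r[symmetric])
  ultimately show ?case
    unfolding integral_last_Suc[where f = "\<lambda>x. r powi (- x) * f x"] integral_last_Suc[where f = "\<lambda>x. f (- x)"]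
    using step_prob_mult_r by (simp flip: mult.assoc)
qed

lemma exponential_moment:
  assumes "0 < u"
  shows "(LINT \<omega>|W n. u powi last \<omega>) = (jump_poly p u / jump_poly p 1) ^ n"
proof (induction n)
  case 0
  show ?case by (simp add: integral_W_0)
next
  case (Suc n)
  have "(LINT \<omega>|W n. u powi (s + last \<omega>)) = u powi s * (LINT \<omega>|W n. u powi last \<omega>)" for s
    using assms by (simp add: power_int_add)
  then have "(LINT \<omega>|W (Suc n). u powi last \<omega>) =
      (step_prob (-1) * inverse u + step_prob 0 + step_prob 1 * u) * (LINT \<omega>|W n. u powi last \<omega>)"
    unfolding integral_last_Suc[where f = "\<lambda>x. u powi x"] by (simp add: algebra_simps power_int_minus)
  also have "step_prob (-1) * inverse u + step_prob 0 + step_prob 1 * u = jump_poly p u / jump_poly p 1"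
    by (simp add: step_prob_def jump_poly_def add_divide_distrib)
  finally show ?case
    by (simp add: Suc.IH)
qed

end

section \<open>Distribution functions of the normal and half-normal laws\<close>

text \<open>
  Altitudes are integers, so a real threshold is replaced by a nearby integer, and the
  rescaled threshold varies with \<open>n\<close>. Monotonicity of distribution functions and continuity of the
  limit absorb this variation.
\<close>

lemma weak_conv_m_cdf_tendsto:
  fixes x :: "nat \<Rightarrow> real"
  assumes \<mu>: "\<And>n. real_distribution (\<mu> n)" and conv: "weak_conv_m \<mu> \<nu>"
    and cont: "\<And>a. isCont (cdf \<nu>) a" and x: "x \<longlonglongrightarrow> a"
  shows "(\<lambda>n. cdf (\<mu> n) (x n)) \<longlonglongrightarrow> cdf \<nu> a"
proof -
  have F: "(\<lambda>n. cdf (\<mu> n) b) \<longlonglongrightarrow> cdf \<nu> b" for b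
    using conv cont by (auto simp: weak_conv_m_def weak_conv_def)
  have mono: "cdf (\<mu> n) b \<le> cdf (\<mu> n) c" if "b \<le> c" for n b c
  proof -
    interpret real_distribution "\<mu> n" by (rule \<mu>)
    show ?thesis using that by (rule cdf_nondecreasing)
  qed
  show ?thesis
  proof (rule order_tendstoI)
    fix y assume "y < cdf \<nu> a"
    then have "\<forall>\<^sub>F b in at a. y < cdf \<nu> b"
      using cont[of a] by (auto simp: isCont_def dest: order_tendstoD)
    then obtain d where "d > 0" "\<And>b. b \<noteq> a \<Longrightarrow> dist b a < d \<Longrightarrow> y < cdf \<nu> b"
      by (auto simp: eventually_at)
    then have b: "y < cdf \<nu> (a - d / 2)"
      by (simp add: dist_real_def)
    have "\<forall>\<^sub>F n in sequentially. y < cdf (\<mu> n) (a - d / 2)"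
      using F b by (rule order_tendstoD)
    moreover have "\<forall>\<^sub>F n in sequentially. a - d / 2 < x n"
      using x \<open>d > 0\<close> by (intro order_tendstoD) auto
    ultimately show "\<forall>\<^sub>F n in sequentially. y < cdf (\<mu> n) (x n)"
    proof eventually_elim
      case (elim n)
      then show ?case
        using mono[of "a - d / 2" "x n" n] by simp
    qed
  next
    fix y assume "cdf \<nu> a < y"
    then have "\<forall>\<^sub>F b in at a. cdf \<nu> b < y"
      using cont[of a] by (auto simp: isCont_def dest: order_tendstoD)
    then obtain d where "d > 0" "\<And>b. b \<noteq> a \<Longrightarrow> dist b a < d \<Longrightarrow> cdf \<nu> b < y"
      by (auto simp: eventually_at)
    then have b: "cdf \<nu> (a + d / 2) < y"
      by (simp add: dist_real_def)
    have "\<forall>\<^sub>F n in sequentially. cdf (\<mu> n) (a + d / 2) < y"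
      using F b by (rule order_tendstoD)
    moreover have "\<forall>\<^sub>F n in sequentially. x n < a + d / 2"
      using x \<open>d > 0\<close> by (intro order_tendstoD) auto
    ultimately show "\<forall>\<^sub>F n in sequentially. cdf (\<mu> n) (x n) < y"
    proof eventually_elim
      case (elim n)
      then show ?case
        using mono[of "x n" "a + d / 2" n] by simp
    qed
  qed
qed

lemma isCont_cdf_std_normal: "isCont (cdf std_normal_distribution) x"
proof -
  interpret real_distribution std_normal_distribution by (rule real_dist_normal_dist)
  have "emeasure std_normal_distribution {x} = 0"
    by (subst emeasure_density) (auto intro!: nn_integral_0_iff_AE[THEN iffD2] AE_mp[OF AE_lborel_singleton[of x]])
  then show ?thesis
    by (simp add: isCont_cdf measure_def)
qed

text \<open>
  The half-normal law is the law of the absolute value of a centred Gaussian variable: half of the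
  doubled density is reflected onto the negative axis.
\<close>

lemma cdf_half_normal:
  assumes \<sigma>: "0 < \<sigma>"
  shows "cdf (half_normal_distribution \<sigma>) x =
    (if x < 0 then 0 else cdf std_normal_distribution (x / \<sigma>) - cdf std_normal_distribution (- (x / \<sigma>)))"
proof (cases "x < 0")
  case True
  have "emeasure (half_normal_distribution \<sigma>) {..x} = 0"
    unfolding half_normal_distribution_def using True
    by (subst emeasure_density) (auto intro!: nn_integral_zero' simp: indicator_def)
  then show ?thesis
    using True by (simp add: cdf_def2 measure_def)
next
  case False
  define y where "y = x / \<sigma>"
  have y: "0 \<le> y" and x: "x = \<sigma> * y"
    using False \<sigma> by (auto simp: y_def)
  interpret real_distribution std_normal_distribution by (rule real_dist_normal_dist)
  have half: "ennreal (if 0 \<le> \<sigma> * t then sqrt (2 / (pi * \<sigma>\<^sup>2)) * exp (- (\<sigma> * t)\<^sup>2 / (2 * \<sigma>\<^sup>2)) else 0) * ennreal \<sigma>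
     = (if 0 \<le> t then 2 * ennreal (std_normal_density t) else 0)" for t
  proof (cases "0 \<le> t")
    case True
    have "sqrt (2 / (pi * \<sigma>\<^sup>2)) = 2 / (sqrt (2 * pi) * \<sigma>)"
      using \<sigma> by (intro real_sqrt_unique) (auto simp: power_mult_distrib power_divide field_simps)
    then have "sqrt (2 / (pi * \<sigma>\<^sup>2)) * exp (- (\<sigma> * t)\<^sup>2 / (2 * \<sigma>\<^sup>2)) * \<sigma> = 2 * std_normal_density t"
      using \<sigma> by (simp add: std_normal_density_def power_mult_distrib)
    then show ?thesis
      using True \<sigma> by (simp add: ennreal_mult'[symmetric] flip: ennreal_numeral)
  next
    case False
    then show ?thesis using \<sigma> by (simp add: zero_le_mult_iff)
  qed
  have "emeasure (half_normal_distribution \<sigma>) {..x} =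
      (\<integral>\<^sup>+t. ennreal (if 0 \<le> t then sqrt (2 / (pi * \<sigma>\<^sup>2)) * exp (- t\<^sup>2 / (2 * \<sigma>\<^sup>2)) else 0) * indicator {..x} t \<partial>lborel)"
    unfolding half_normal_distribution_def by (subst emeasure_density) auto
  also have "\<dots> = ennreal \<sigma> * (\<integral>\<^sup>+t. ennreal (if 0 \<le> \<sigma> * t then sqrt (2 / (pi * \<sigma>\<^sup>2)) * exp (- (\<sigma> * t)\<^sup>2 / (2 * \<sigma>\<^sup>2)) else 0)
      * indicator {..y} t \<partial>lborel)"
    using \<sigma> by (subst nn_integral_real_affine[where c = \<sigma> and t = 0])
      (auto simp: x indicator_def intro!: arg_cong[where f = "(*) _"] nn_integral_cong)
  also have "\<dots> = (\<integral>\<^sup>+t. 2 * ennreal (std_normal_density t) * indicator {0..y} t \<partial>lborel)"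
  proof (subst nn_integral_cmult[symmetric], simp, rule nn_integral_cong)
    fix t
    show "ennreal \<sigma> * (ennreal (if 0 \<le> \<sigma> * t then sqrt (2 / (pi * \<sigma>\<^sup>2)) * exp (- (\<sigma> * t)\<^sup>2 / (2 * \<sigma>\<^sup>2)) else 0)
      * indicator {..y} t) = 2 * ennreal (std_normal_density t) * indicator {0..y} t"
      using half[of t] by (cases "t \<le> y") (auto simp: indicator_def mult.commute)
  qed
  also have "\<dots> = (\<integral>\<^sup>+t. ennreal (std_normal_density t) * indicator {0..y} t \<partial>lborel) +
      (\<integral>\<^sup>+t. ennreal (std_normal_density t) * indicator {0..y} t \<partial>lborel)"
    by (subst nn_integral_add[symmetric]) (auto intro!: nn_integral_cong simp: mult_2 indicator_def)
  also have "\<dots> = (\<integral>\<^sup>+t. ennreal (std_normal_density t) * indicator {-y..0} t \<partial>lborel) +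
      (\<integral>\<^sup>+t. ennreal (std_normal_density t) * indicator {0..y} t \<partial>lborel)"
    by (subst (1) nn_integral_real_affine[where c = "-1" and t = 0])
       (auto intro!: arg_cong2[where f = "(+)"] nn_integral_cong simp: std_normal_density_def indicator_def)
  also have "\<dots> = (\<integral>\<^sup>+t. ennreal (std_normal_density t) * indicator {-y<..y} t \<partial>lborel)"
  proof (subst nn_integral_add[symmetric], simp, simp, rule nn_integral_cong_AE)
    show "AE t in lborel. ennreal (std_normal_density t) * indicator {-y..0} t +
        ennreal (std_normal_density t) * indicator {0..y} t =
        ennreal (std_normal_density t) * indicator {-y<..y} t"
      using AE_lborel_singleton[of 0] AE_lborel_singleton[of "-y"]
      by eventually_elim (use y in \<open>auto simp: indicator_def\<close>)
  qed
  also have "\<dots> = emeasure std_normal_distribution {-y<..y}"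
    by (subst emeasure_density) auto
  finally have "measure (half_normal_distribution \<sigma>) {..x} = prob {-y<..y}"
    by (simp add: measure_def)
  also have "\<dots> = cdf std_normal_distribution y - cdf std_normal_distribution (- y)"
    using y by (cases "y = 0") (auto simp: cdf_diff_eq)
  finally show ?thesis
    using False by (simp add: cdf_def2 y_def)
qed

context motzkin_weights
begin

section \<open>The central limit theorem for the final altitude\<close>

definition step_mean :: real where
  "step_mean = step_prob 1 - step_prob (-1)"

definition step_var :: real where
  "step_var = step_prob 1 + step_prob (-1) - step_mean\<^sup>2"

lemma step_var_pos: "0 < step_var"
proof -
  have "step_prob 1 + step_prob (-1) < 1" "0 < step_prob 1 + step_prob (-1)"
    using step_prob_sum step_prob_pos by linarith+
  moreover have "step_mean\<^sup>2 \<le> (step_prob 1 + step_prob (-1))\<^sup>2"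
    unfolding step_mean_def using step_prob_pos by (intro power2_le_iff_abs_le[THEN iffD2]) auto
  moreover have "(step_prob 1 + step_prob (-1))\<^sup>2 < (step_prob 1 + step_prob (-1)) * 1"
    unfolding power2_eq_square using calculation by (intro mult_strict_left_mono) auto
  ultimately show ?thesis
    by (simp add: step_var_def)
qed

lemma char_last:
  "char (distr (W n) borel (\<lambda>\<omega>. real_of_int (last \<omega>))) t =
    (\<Sum>s\<in>{-1, 0, 1}. step_prob s *\<^sub>R iexp (t * real_of_int s)) ^ n"
proof -
  have "char (distr (W n) borel (\<lambda>\<omega>. real_of_int (last \<omega>))) t =
    (LINT \<omega>|W n. iexp (t * real_of_int (last \<omega>)))" for n
    unfolding char_def by (subst integral_distr) auto
  moreover have "(LINT \<omega>|W n. iexp (t * real_of_int (last \<omega>))) =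
      (\<Sum>s\<in>{-1, 0, 1}. step_prob s *\<^sub>R iexp (t * real_of_int s)) ^ n"
  proof (induction n)
    case 0
    show ?case by (simp add: integral_W_0)
  next
    case (Suc n)
    have "(LINT \<omega>|W n. iexp (t * real_of_int (s + last \<omega>))) =
        iexp (t * real_of_int s) * (LINT \<omega>|W n. iexp (t * real_of_int (last \<omega>)))" for s
      unfolding integral_mult_right_zero[symmetric]
      by (intro integral_W_cong) (simp add: algebra_simps exp_add)
    then show ?case
      unfolding integral_last_Suc[where f = "\<lambda>x. iexp (t * real_of_int x)"] Suc.IH
      by (simp add: algebra_simps)
  qed
  ultimately show ?thesis by simp
qed

text \<open>
  The final altitude has the law of a sum of independent copies of a one-step walk. The copies live
  on an infinite power of the space of walks of length 1, where the classical central limit theorem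
  applies; the two laws agree since both have the characteristic function \<open>char_last\<close>.
\<close>

theorem central_limit_last:
  "weak_conv_m
    (\<lambda>n. distr (W n) borel (\<lambda>\<omega>. (real_of_int (last \<omega>) - step_mean * real n) / sqrt (real n * step_var)))
    std_normal_distribution"
proof -
  define X :: "nat \<Rightarrow> (nat \<Rightarrow> int list) \<Rightarrow> real" where "X i f = real_of_int (last (f i))" for i f
  define \<Omega> where "\<Omega> = Pi\<^sub>M UNIV (\<lambda>_::nat. W 1)"
  define \<nu> where "\<nu> = distr (W 1) borel (\<lambda>\<omega>. real_of_int (last \<omega>))"
  interpret W1: prob_space "W 1" by (rule prob_space_W)
  interpret product_prob_space "\<lambda>_::nat. W 1" UNIV ..
  interpret prob_space \<Omega>
    unfolding \<Omega>_def by (rule prob_space_PiM) (rule prob_space_W)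
  have measurable_lastW: "(\<lambda>\<omega>. real_of_int (last \<omega>)) \<in> W 1 \<rightarrow>\<^sub>M borel"
    by simp
  have coord [measurable]: "(\<lambda>f. f i) \<in> \<Omega> \<rightarrow>\<^sub>M W 1" for i
    unfolding \<Omega>_def by (rule measurable_component_singleton) simp
  have X [measurable]: "X i \<in> borel_measurable \<Omega>" for i
    unfolding X_def by (rule measurable_compose[OF coord]) simp
  have "distr \<Omega> (W 1) (\<lambda>f. f i) = W 1" for i
    unfolding \<Omega>_def by (rule PiM_component) simp
  then have distr_X: "distr \<Omega> borel (X i) = \<nu>" for i
    unfolding X_def \<nu>_def
    using distr_distr[OF measurable_lastW coord[of i]] by (simp add: comp_def)
  have "indep_vars (\<lambda>_. W 1) (\<lambda>i f. f i) (UNIV :: nat set)"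
  proof (subst indep_vars_iff_distr_eq_PiM')
    show "distr \<Omega> (Pi\<^sub>M UNIV (\<lambda>i. W 1)) (\<lambda>x. \<lambda>i\<in>UNIV. x i) =
        Pi\<^sub>M UNIV (\<lambda>i. distr \<Omega> (W 1) (\<lambda>f. f i))"
      using \<open>\<And>i. distr \<Omega> (W 1) (\<lambda>f. f i) = W 1\<close>
      by (simp add: \<Omega>_def restrict_UNIV del: One_nat_def)
  qed (simp, rule coord)
  then have indep: "indep_vars (\<lambda>_. borel) X UNIV"
    unfolding X_def
    by (rule indep_vars_compose2[where Y = "\<lambda>_ \<omega>. real_of_int (last \<omega>)"]) (rule measurable_lastW)
  have step: "(LINT f|\<Omega>. g (X i f)) = (\<Sum>s\<in>{-1, 0, 1}. step_prob s * g (real_of_int s))"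
    if [measurable]: "g \<in> borel_measurable borel" for g :: "real \<Rightarrow> real" and i
  proof -
    have "(LINT f|\<Omega>. g (X i f)) = integral\<^sup>L \<nu> g"
      by (simp add: integral_distr flip: distr_X[of i])
    also have "\<dots> = (LINT \<omega>|W (Suc 0). g (real_of_int (last \<omega>)))"
      unfolding \<nu>_def by (subst integral_distr) auto
    also have "\<dots> = (\<Sum>s\<in>{-1, 0, 1}. step_prob s * g (real_of_int s))"
      by (subst integral_last_Suc[where f = "\<lambda>x. g (real_of_int x)"]) (simp add: integral_W_0)
    finally show ?thesis .
  qed
  have mean: "expectation (X i) = step_mean" for i
    using step[of "\<lambda>x. x" i] by (simp add: step_mean_def)
  have "weak_conv_m
     (\<lambda>n. distr \<Omega> borel (\<lambda>f. (\<Sum>i<n. X i f - step_mean) / sqrt (real n * (sqrt step_var)\<^sup>2))) std_normal_distribution"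
  proof (rule central_limit_theorem[OF indep mean _ _ _ distr_X])
    show "0 < sqrt step_var" using step_var_pos by simp
    show "integrable \<Omega> (\<lambda>f. (X i f)\<^sup>2)" for i
    proof -
      have "integrable \<nu> (\<lambda>x. x\<^sup>2)"
        unfolding \<nu>_def by (subst integrable_distr_eq) auto
      then show ?thesis
        by (simp add: integrable_distr_eq flip: distr_X[of i])
    qed
    show "variance (X i) = (sqrt step_var)\<^sup>2" for i
    proof -
      have "variance (X i) = step_prob (-1) * (-1 - step_mean)\<^sup>2 + step_prob 0 * step_mean\<^sup>2 + step_prob 1 * (1 - step_mean)\<^sup>2"
        unfolding mean using step[of "\<lambda>x. (x - step_mean)\<^sup>2" i] by simp
      also have "\<dots> = step_prob (-1) + step_prob 1 - 2 * step_mean * (step_prob 1 - step_prob (-1)) + (step_prob (-1) + step_prob 0 + step_prob 1) * step_mean\<^sup>2"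
        by (simp add: power2_eq_square algebra_simps)
      also have "\<dots> = step_var"
        by (simp add: step_prob_sum step_var_def power2_eq_square flip: step_mean_def)
      finally show ?thesis using step_var_pos by simp
    qed
  qed
  moreover have "distr \<Omega> borel (\<lambda>f. (\<Sum>i<n. X i f - step_mean) / sqrt (real n * (sqrt step_var)\<^sup>2)) =
      distr (W n) borel (\<lambda>\<omega>. (real_of_int (last \<omega>) - step_mean * real n) / sqrt (real n * step_var))" for n
  proof -
    interpret Wn: prob_space "W n" by (rule prob_space_W)
    have "distr \<Omega> borel (\<lambda>f. \<Sum>i<n. X i f) = distr (W n) borel (\<lambda>\<omega>. real_of_int (last \<omega>))"
    proof (rule Levy_uniqueness)
      show "char (distr \<Omega> borel (\<lambda>f. \<Sum>i<n. X i f)) =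
          char (distr (W n) borel (\<lambda>\<omega>. real_of_int (last \<omega>)))"
      proof
        fix t
        have "char (distr \<Omega> borel (\<lambda>f. \<Sum>i<n. X i f)) t = (\<Prod>i<n. char (distr \<Omega> borel (X i)) t)"
          by (rule char_distr_sum, rule indep_vars_subset[OF indep]) auto
        then show "char (distr \<Omega> borel (\<lambda>f. \<Sum>i<n. X i f)) t =
            char (distr (W n) borel (\<lambda>\<omega>. real_of_int (last \<omega>))) t"
          by (simp only: distr_X \<nu>_def char_last power_one_right prod_constant card_lessThan)
      qed
    qed (auto intro!: real_distribution_distr Wn.real_distribution_distr)
    then have "distr (distr \<Omega> borel (\<lambda>f. \<Sum>i<n. X i f)) borel (\<lambda>x. (x - step_mean * real n) / sqrt (real n * step_var)) =
        distr (distr (W n) borel (\<lambda>\<omega>. real_of_int (last \<omega>))) borel (\<lambda>x. (x - step_mean * real n) / sqrt (real n * step_var))"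
      by simp
    then show ?thesis
      using step_var_pos by (simp add: distr_distr comp_def sum_subtractf mult.commute)
  qed
  ultimately show ?thesis by simp
qed

lemma prob_last_le_tendsto:
  assumes "(\<lambda>n. (y n - step_mean * real n) / sqrt (real n * step_var)) \<longlonglongrightarrow> a"
  shows "(\<lambda>n. LINT \<omega>|W n. of_bool (real_of_int (last \<omega>) \<le> y n)) \<longlonglongrightarrow> cdf std_normal_distribution a"
proof -
  let ?D = "\<lambda>n. distr (W n) borel (\<lambda>\<omega>. (real_of_int (last \<omega>) - step_mean * real n) / sqrt (real n * step_var))"
  have "(\<lambda>n. cdf (?D n) ((y n - step_mean * real n) / sqrt (real n * step_var))) \<longlonglongrightarrow> cdf std_normal_distribution a"
    by (rule weak_conv_m_cdf_tendsto[OF _ central_limit_last isCont_cdf_std_normal assms])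
       (intro prob_space.real_distribution_distr prob_space_W, simp)
  moreover have "\<forall>\<^sub>F n in sequentially. cdf (?D n) ((y n - step_mean * real n) / sqrt (real n * step_var)) =
      (LINT \<omega>|W n. of_bool (real_of_int (last \<omega>) \<le> y n))"
    using eventually_gt_at_top[of 0]
  proof eventually_elim
    case (elim n)
    then show ?case
      using step_var_pos by (simp add: cdf_distr_W divide_le_cancel mult_less_0_iff)
  qed
  ultimately show ?thesis
    by (simp cong: tendsto_cong)
qed

text \<open>
  Any error of smaller order than the standard deviation is harmless. The fourth root of \<open>n\<close>
  leaves room for the growing window needed in the case of positive drift, and the constant 2 for
  rounding.
\<close>

lemma prob_last_le_near_tendsto:
  fixes k :: "nat \<Rightarrow> int"
  assumes "\<And>n. \<bar>real_of_int (k n) - (step_mean * real n + a * sqrt (real n * step_var))\<bar> \<le> 2 + sqrt (sqrt (real n))"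
  shows "(\<lambda>n. LINT \<omega>|W n. of_bool (last \<omega> \<le> k n)) \<longlonglongrightarrow> cdf std_normal_distribution a"
proof -
  have "(\<lambda>n. (real_of_int (k n) - step_mean * real n) / sqrt (real n * step_var) - a) \<longlonglongrightarrow> 0"
  proof (rule Lim_null_comparison)
    show "\<forall>\<^sub>F n in sequentially. norm ((real_of_int (k n) - step_mean * real n) / sqrt (real n * step_var) - a)
        \<le> (2 + sqrt (sqrt (real n))) / sqrt (real n * step_var)"
      using eventually_gt_at_top[of 0]
    proof eventually_elim
      case (elim n)
      then have s: "0 < sqrt (real n * step_var)"
        using step_var_pos by simp
      then have "(real_of_int (k n) - step_mean * real n) / sqrt (real n * step_var) - a =
          (real_of_int (k n) - (step_mean * real n + a * sqrt (real n * step_var))) / sqrt (real n * step_var)"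
        using elim step_var_pos by (simp only: diff_divide_distrib add_divide_distrib) simp
      then show ?case
        using assms[of n] s by (simp add: divide_right_mono)
    qed
    show "(\<lambda>n. (2 + sqrt (sqrt (real n))) / sqrt (real n * step_var)) \<longlonglongrightarrow> 0"
    proof -
      have "(\<lambda>n. (2 + sqrt (sqrt (real n))) / sqrt (real n)) \<longlonglongrightarrow> 0"
        by real_asymp
      from tendsto_divide_zero[OF this, of "sqrt step_var"] show ?thesis
        by (simp add: real_sqrt_mult)
    qed
  qed
  then have "(\<lambda>n. (real_of_int (k n) - step_mean * real n) / sqrt (real n * step_var)) \<longlonglongrightarrow> a"
    by (rule LIM_zero_cancel)
  from prob_last_le_tendsto[OF this] show ?thesis
    by simp
qed

end

section \<open>The distribution function of the geometric law\<close>

lemma cdf_geometric: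
  assumes "0 < r" "r < 1"
  shows "cdf (geometric_distribution (1 - r)) x = (if x < 0 then 0 else 1 - r powi (\<lfloor>x\<rfloor> + 1))"
proof -
  have cdf: "cdf (geometric_distribution (1 - r)) x = measure (geometric_pmf (1 - r)) {k. real k \<le> x}"
    by (simp add: geometric_distribution_def cdf_def measure_distr vimage_def)
  show ?thesis
  proof (cases "x < 0")
    case True
    then have "{k. real k \<le> x} = {}"
      by auto
    then show ?thesis
      using True cdf by simp
  next
    case False
    then have set_eq: "{k. real k \<le> x} = {..<Suc (nat \<lfloor>x\<rfloor>)}"
      by (auto simp: le_nat_iff le_floor_iff less_Suc_eq_le)
    have "measure (geometric_pmf (1 - r)) {k. real k \<le> x} = (1 - r) * (\<Sum>k<Suc (nat \<lfloor>x\<rfloor>). r ^ k)"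
      unfolding set_eq using assms
      by (subst measure_measure_pmf_finite) (simp_all only: sum_distrib_left mult.commute finite_lessThan pmf_geometric, auto simp: mult.commute)
    also have "\<dots> = 1 - r ^ Suc (nat \<lfloor>x\<rfloor>)"
      by (rule one_diff_power_eq[symmetric])
    also have "r ^ Suc (nat \<lfloor>x\<rfloor>) = r powi (\<lfloor>x\<rfloor> + 1)"
      using False by (simp add: power_int_def nat_add_distrib)
    finally show ?thesis
      using False cdf by simp
  qed
qed

context motzkin_weights
begin

section \<open>The distribution function of the height\<close>

lemma height_le_neg:
  "x < 0 \<Longrightarrow> (LINT \<omega>|W n. of_bool (real_of_int (height \<omega>) \<le> x)) = (0 :: real)"
proof -
  assume x: "x < 0"
  have "(LINT \<omega>|W n. of_bool (real_of_int (height \<omega>) \<le> x)) = (LINT \<omega>|W n. (0 :: real))"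
  proof (rule integral_W_cong)
    fix \<omega> assume "\<omega> \<in> motzkin_walks n"
    then have "0 \<le> height \<omega>"
      by (rule height_nonneg)
    then have "0 \<le> real_of_int (height \<omega>)"
      by simp
    then show "of_bool (real_of_int (height \<omega>) \<le> x) = (0 :: real)"
      using x by simp
  qed
  then show ?thesis by simp
qed

lemma height_le:
  assumes "0 \<le> x" and k_def: "k = \<lfloor>x\<rfloor> + 1"
  shows "(LINT \<omega>|W n. of_bool (real_of_int (height \<omega>) \<le> x)) =
    (LINT \<omega>|W n. of_bool (last \<omega> \<le> k)) - r powi k * (LINT \<omega>|W n. of_bool (last \<omega> \<le> - k))"
proof -
  interpret prob_space "W n" by (rule prob_space_W)
  have "0 \<le> k"
    using assms by simp
  have "(LINT \<omega>|W n. of_bool (real_of_int (height \<omega>) \<le> x)) = (LINT \<omega>|W n. 1 - of_bool (k \<le> height \<omega>) :: real)"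
    unfolding k_def by (rule integral_W_cong) (auto simp: le_floor_iff[symmetric] of_bool_def)
  also have "\<dots> = 1 - (LINT \<omega>|W n. of_bool (k \<le> height \<omega>))"
    by (simp add: prob_space)
  also have "\<dots> = (1 - (LINT \<omega>|W n. of_bool (k < last \<omega>))) - r powi k * (LINT \<omega>|W n. of_bool (last \<omega> \<le> - k))"
    by (simp add: height_tail[OF \<open>0 \<le> k\<close>])
  also have "1 - (LINT \<omega>|W n. of_bool (k < last \<omega>)) = (LINT \<omega>|W n. 1 - of_bool (k < last \<omega>) :: real)"
    by (simp add: prob_space)
  also have "\<dots> = (LINT \<omega>|W n. of_bool (last \<omega> \<le> k))"
    by (rule integral_W_cong) (auto simp: of_bool_def)
  finally show ?thesis .
qed

section \<open>Negative drift\<close>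

text \<open>
  Markov's inequality for \<open>u powi last\<close>, whose expectation decays exponentially once
  \<open>jump_poly p u < jump_poly p 1\<close> for some \<open>u > 1\<close>.
\<close>

lemma prob_last_le_tendsto_1:
  assumes "r < 1"
  shows "(\<lambda>n. LINT \<omega>|W n. of_bool (last \<omega> \<le> j)) \<longlonglongrightarrow> (1 :: real)"
proof -
  \<comment> \<open>The minimiser of the jump polynomial on the positive axis, which lies beyond 1 for negative drift.\<close>
  define u where "u = sqrt (1 / r)"
  have u: "1 < u"
    using assms r_pos by (simp add: u_def)
  have "p (-1) = p 1 * u\<^sup>2"
    using pos r_pos by (simp add: u_def r_def)
  then have "jump_poly p 1 - jump_poly p u = p 1 * (u - 1)\<^sup>2"
    using u by (simp add: jump_poly_def field_simps power2_eq_square)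
  moreover have "0 < p 1 * (u - 1)\<^sup>2"
    using u pos by simp
  ultimately have less: "jump_poly p u < jump_poly p 1"
    by simp
  have "0 < jump_poly p u"
    using u pos by (simp add: jump_poly_def add_pos_pos)
  define \<rho> where "\<rho> = jump_poly p u / jump_poly p 1"
  have \<rho>: "0 < \<rho>" "\<rho> < 1"
    using less \<open>0 < jump_poly p u\<close> by (simp_all add: \<rho>_def)
  have lower: "1 - u powi (- j) * \<rho> ^ n \<le> (LINT \<omega>|W n. of_bool (last \<omega> \<le> j))" for n
  proof -
    interpret prob_space "W n" by (rule prob_space_W)
    have "1 - u powi (- j) * \<rho> ^ n = (LINT \<omega>|W n. 1 - u powi (- j) * u powi last \<omega>)"
      using exponential_moment[of u n] u by (simp add: prob_space \<rho>_def)
    also have "\<dots> \<le> (LINT \<omega>|W n. of_bool (last \<omega> \<le> j))"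
    proof (intro integral_mono integrable_W)
      fix \<omega>
      show "1 - u powi (- j) * u powi last \<omega> \<le> of_bool (last \<omega> \<le> j)"
      proof (cases "last \<omega> \<le> j")
        case True
        then show ?thesis using u by simp
      next
        case False
        then have "1 \<le> u powi (- j + last \<omega>)"
          using u by (intro one_le_power_int) auto
        then show ?thesis
          using u False by (subst power_int_add[symmetric]) auto
      qed
    qed
    finally show ?thesis .
  qed
  have upper: "(LINT \<omega>|W n. of_bool (last \<omega> \<le> j)) \<le> (1 :: real)" for n
  proof -
    interpret prob_space "W n" by (rule prob_space_W)
    have "(LINT \<omega>|W n. of_bool (last \<omega> \<le> j)) \<le> (LINT \<omega>|W n. (1 :: real))"
      by (intro integral_mono integrable_W) auto
    then show ?thesis by (simp add: prob_space)
  qed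
  have "(\<lambda>n. 1 - u powi (- j) * \<rho> ^ n) \<longlonglongrightarrow> 1 - u powi (- j) * 0"
    using \<rho> by (intro tendsto_intros LIMSEQ_power_zero) auto
  then have lower_lim: "(\<lambda>n. 1 - u powi (- j) * \<rho> ^ n) \<longlonglongrightarrow> 1"
    by simp
  show ?thesis
    by (rule tendsto_sandwich[OF always_eventually always_eventually lower_lim tendsto_const])
       (use lower upper in blast)+
qed

theorem height_negative_drift:
  assumes "r < 1"
  shows "weak_conv_m (\<lambda>n. distr (W n) borel (\<lambda>\<omega>. real_of_int (height \<omega>))) (geometric_distribution (1 - r))"
  unfolding weak_conv_m_def weak_conv_def cdf_distr_W cdf_geometric[OF r_pos assms]
proof (intro allI impI)
  fix x :: real
  show "(\<lambda>n. LINT \<omega>|W n. of_bool (real_of_int (height \<omega>) \<le> x)) \<longlonglongrightarrow>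
      (if x < 0 then 0 else 1 - r powi (\<lfloor>x\<rfloor> + 1))"
  proof (cases "x < 0")
    case True
    then show ?thesis by (simp add: height_le_neg)
  next
    case False
    define k where "k = \<lfloor>x\<rfloor> + 1"
    have "(\<lambda>n. (LINT \<omega>|W n. of_bool (last \<omega> \<le> k)) - r powi k * (LINT \<omega>|W n. of_bool (last \<omega> \<le> - k)))
        \<longlonglongrightarrow> 1 - r powi k * 1"
      by (intro tendsto_intros prob_last_le_tendsto_1 assms)
    then show ?thesis
      using False by (simp add: height_le[OF _ k_def]) (simp add: k_def)
  qed
qed

section \<open>Zero drift\<close>

theorem height_zero_drift:
  assumes "r = 1"
  shows "weak_conv_m (\<lambda>n. distr (W n) borel (\<lambda>\<omega>. real_of_int (height \<omega>) / sqrt (real n)))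
    (half_normal_distribution (sqrt step_var))"
proof -
  have step_mean: "step_mean = 0"
    using assms step_prob_mult_r by (simp add: step_mean_def)
  have "0 < sqrt step_var"
    using step_var_pos by simp
  show ?thesis
    unfolding weak_conv_m_def weak_conv_def cdf_distr_W cdf_half_normal[OF \<open>0 < sqrt step_var\<close>]
  proof (intro allI impI)
    fix x :: real
    define k where "k n = \<lfloor>x * sqrt (real n)\<rfloor> + 1" for n
    have scale: "\<forall>\<^sub>F n in sequentially. (LINT \<omega>|W n. of_bool (real_of_int (height \<omega>) / sqrt (real n) \<le> x))
        = (LINT \<omega>|W n. of_bool (real_of_int (height \<omega>) \<le> x * sqrt (real n)) :: real)"
      using eventually_gt_at_top[of 0] by eventually_elim (simp add: divide_le_eq)
    show "(\<lambda>n. LINT \<omega>|W n. of_bool (real_of_int (height \<omega>) / sqrt (real n) \<le> x)) \<longlonglongrightarrow>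
        (if x < 0 then 0
         else cdf std_normal_distribution (x / sqrt step_var) - cdf std_normal_distribution (- (x / sqrt step_var)))"
    proof (cases "x < 0")
      case True
      have "\<forall>\<^sub>F n in sequentially. (LINT \<omega>|W n. of_bool (real_of_int (height \<omega>) / sqrt (real n) \<le> x)) = (0 :: real)"
        using scale eventually_gt_at_top[of 0]
        by eventually_elim (use True in \<open>simp add: height_le_neg mult_neg_pos\<close>)
      then show ?thesis
        using True by (simp add: tendsto_eventually)
    next
      case False
      have k: "\<bar>real_of_int (k n) - x * sqrt (real n)\<bar> \<le> 2" for n
        unfolding k_def by linarith
      have "\<bar>real_of_int (k n) - (step_mean * real n + x / sqrt step_var * sqrt (real n * step_var))\<bar> \<le> 2 + sqrt (sqrt (real n))" for n
        using k[of n] step_var_pos by (simp add: step_mean real_sqrt_mult add_increasing2)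
      moreover have "\<bar>real_of_int (- k n) - (step_mean * real n + - (x / sqrt step_var) * sqrt (real n * step_var))\<bar> \<le> 2 + sqrt (sqrt (real n))" for n
        using k[of n] step_var_pos by (simp add: step_mean real_sqrt_mult add_increasing2 abs_minus_commute)
      ultimately have "(\<lambda>n. (LINT \<omega>|W n. of_bool (last \<omega> \<le> k n)) - (LINT \<omega>|W n. of_bool (last \<omega> \<le> - k n)))
          \<longlonglongrightarrow> cdf std_normal_distribution (x / sqrt step_var) - cdf std_normal_distribution (- (x / sqrt step_var))"
        by (intro tendsto_diff prob_last_le_near_tendsto)
      moreover have "\<forall>\<^sub>F n in sequentially. (LINT \<omega>|W n. of_bool (last \<omega> \<le> k n)) - (LINT \<omega>|W n. of_bool (last \<omega> \<le> - k n))
          = (LINT \<omega>|W n. of_bool (real_of_int (height \<omega>) / sqrt (real n) \<le> x) :: real)"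
        using scale
      proof eventually_elim
        case (elim n)
        have "0 \<le> x * sqrt (real n)"
          using False by simp
        then show ?case
          unfolding elim by (subst height_le[OF _ k_def]) (simp_all add: assms)
      qed
      ultimately show ?thesis
        using False by (auto elim: Lim_transform_eventually)
    qed
  qed
qed

section \<open>Positive drift\<close>

text \<open>
  By \<open>reflect_last\<close> the left-hand side is the expectation of \<open>r powi (k - last)\<close> on the event
  \<open>k \<le> last\<close>. The integrand is at most 1 while \<open>last \<le> k + m\<close>, and at most \<open>r powi (- m)\<close> beyond.
\<close>

lemma reflected_tail_bound:
  assumes "1 \<le> r" "0 \<le> m"
  shows "r powi k * (LINT \<omega>|W n. of_bool (last \<omega> \<le> - k)) \<le>
    (LINT \<omega>|W n. of_bool (last \<omega> \<le> k + m)) - (LINT \<omega>|W n. of_bool (last \<omega> \<le> k - 1)) + r powi (- m)"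
proof -
  interpret prob_space "W n" by (rule prob_space_W)
  have "r powi k * (LINT \<omega>|W n. of_bool (last \<omega> \<le> - k)) =
      r powi k * (LINT \<omega>|W n. r powi (- last \<omega>) * of_bool (k \<le> last \<omega>))"
    by (subst reflect_last) (auto intro!: integral_W_cong arg_cong[where f = of_bool])
  also have "\<dots> = (LINT \<omega>|W n. r powi (k - last \<omega>) * of_bool (k \<le> last \<omega>))"
    unfolding integral_mult_right_zero[symmetric]
    using r_pos by (intro integral_W_cong) (simp add: power_int_diff power_int_minus field_simps)
  also have "\<dots> \<le> (LINT \<omega>|W n. of_bool (last \<omega> \<le> k + m) - of_bool (last \<omega> \<le> k - 1) + r powi (- m))"
  proof (intro integral_mono integrable_W)
    fix \<omega>
    have "r powi (k - last \<omega>) \<le> r powi 0" if "k \<le> last \<omega>"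
      using that assms by (intro power_int_increasing) auto
    moreover have "r powi (k - last \<omega>) \<le> r powi (- m)" if "k + m < last \<omega>"
      using that assms by (intro power_int_increasing) auto
    moreover have "0 \<le> r powi j" for j
      using r_pos by simp
    ultimately show "r powi (k - last \<omega>) * of_bool (k \<le> last \<omega>) \<le>
        of_bool (last \<omega> \<le> k + m) - of_bool (last \<omega> \<le> k - 1) + r powi (- m)"
      using assms by (auto simp: of_bool_def intro: add_increasing2)
  qed
  also have "\<dots> = (LINT \<omega>|W n. of_bool (last \<omega> \<le> k + m)) - (LINT \<omega>|W n. of_bool (last \<omega> \<le> k - 1)) + r powi (- m)"
    by (simp add: prob_space)
  finally show ?thesis .
qed

theorem height_positive_drift:
  assumes "1 < r"
  shows "weak_conv_m
    (\<lambda>n. distr (W n) borel (\<lambda>\<omega>. (real_of_int (height \<omega>) - step_mean * real n) / (sqrt step_var * sqrt (real n))))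
    std_normal_distribution"
  unfolding weak_conv_m_def weak_conv_def cdf_distr_W
proof (intro allI impI)
  fix x :: real
  define y where "y n = step_mean * real n + x * sqrt (real n * step_var)" for n :: nat
  define k where "k n = \<lfloor>y n\<rfloor> + 1" for n
  \<comment> \<open>The length of the window must tend to infinity, but more slowly than the standard deviation.\<close>
  define m where "m n = \<lfloor>sqrt (sqrt (real n))\<rfloor>" for n
  have m_nonneg: "0 \<le> m n" for n
    by (simp add: m_def)
  let ?F = "\<lambda>j n. (LINT \<omega>|W n. of_bool (last \<omega> \<le> j n)) :: real"
  let ?R = "\<lambda>n. r powi k n * (LINT \<omega>|W n. of_bool (last \<omega> \<le> - k n))"
  have near: "?F j \<longlonglongrightarrow> cdf std_normal_distribution x"
    if "\<And>n. k n - 1 \<le> j n" "\<And>n. j n \<le> k n + m n" for j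
  proof (rule prob_last_le_near_tendsto)
    fix n
    have "real_of_int (m n) \<le> sqrt (sqrt (real n))"
      by (simp add: m_def)
    moreover have "real_of_int (j n) \<le> real_of_int (k n) + real_of_int (m n)" "real_of_int (k n) - 1 \<le> real_of_int (j n)"
      using that[of n] by linarith+
    moreover have "y n < real_of_int (k n)" "real_of_int (k n) \<le> y n + 1"
      unfolding k_def by linarith+
    ultimately have "\<bar>real_of_int (j n) - y n\<bar> \<le> 2 + sqrt (sqrt (real n))"
      using real_sqrt_ge_zero[of "sqrt (real n)"] by (simp add: abs_le_iff)
    then show "\<bar>real_of_int (j n) - (step_mean * real n + x * sqrt (real n * step_var))\<bar> \<le> 2 + sqrt (sqrt (real n))"
      by (simp add: y_def)
  qed
  have "?R \<longlonglongrightarrow> 0"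
  proof (rule tendsto_sandwich[OF always_eventually always_eventually tendsto_const])
    show "\<forall>n. 0 \<le> ?R n"
      using r_pos by (auto intro!: mult_nonneg_nonneg integral_nonneg)
    show "\<forall>n. ?R n \<le> ?F (\<lambda>n. k n + m n) n - ?F (\<lambda>n. k n - 1) n + r powi (- m n)"
      using assms m_nonneg by (intro allI reflected_tail_bound) auto
    have "filterlim m at_top sequentially"
      unfolding m_def
      by (rule filterlim_compose[OF filterlim_floor_sequentially]) real_asymp
    then have "(\<lambda>n. (1 / r) ^ nat (m n)) \<longlonglongrightarrow> 0"
      using assms by (intro filterlim_compose[OF LIMSEQ_power_zero] filterlim_compose[OF filterlim_nat_sequentially]) auto
    moreover have "(1 / r) ^ nat (m n) = r powi (- m n)" for n
      using m_nonneg[of n] by (simp add: power_int_def power_one_over inverse_eq_divide)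
    ultimately have "(\<lambda>n. r powi (- m n)) \<longlonglongrightarrow> 0"
      by simp
    moreover have "k n - 1 \<le> k n + m n" for n
      using m_nonneg[of n] by simp
    ultimately have "(\<lambda>n. ?F (\<lambda>n. k n + m n) n - ?F (\<lambda>n. k n - 1) n + r powi (- m n)) \<longlonglongrightarrow>
        cdf std_normal_distribution x - cdf std_normal_distribution x + 0"
      using m_nonneg by (intro tendsto_add tendsto_diff near) simp_all
    then show "(\<lambda>n. ?F (\<lambda>n. k n + m n) n - ?F (\<lambda>n. k n - 1) n + r powi (- m n)) \<longlonglongrightarrow> 0"
      by simp
  qed
  then have "(\<lambda>n. ?F k n - ?R n) \<longlonglongrightarrow> cdf std_normal_distribution x - 0"
    using m_nonneg by (intro tendsto_diff near) auto
  moreover have "\<forall>\<^sub>F n in sequentially. ?F k n - ?R n =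
      (LINT \<omega>|W n. of_bool ((real_of_int (height \<omega>) - step_mean * real n) / (sqrt step_var * sqrt (real n)) \<le> x))"
  proof -
    have "0 < step_mean"
      using assms step_prob_mult_r step_prob_pos by (simp add: step_mean_def mult_less_cancel_left1 flip: step_prob_mult_r)
    then have "filterlim y at_top sequentially"
    proof -
      have "(\<lambda>n. x * sqrt step_var * (1 / sqrt (real n))) \<longlonglongrightarrow> x * sqrt step_var * 0"
        by (intro tendsto_mult tendsto_const) real_asymp
      then have "(\<lambda>n. step_mean + x * sqrt step_var * (1 / sqrt (real n))) \<longlonglongrightarrow> step_mean + 0"
        by (intro tendsto_add tendsto_const) simp
      then have "filterlim (\<lambda>n. (step_mean + x * sqrt step_var * (1 / sqrt (real n))) * real n) at_top sequentially"
        using \<open>0 < step_mean\<close> by (intro filterlim_tendsto_pos_mult_at_top[OF _ _ filterlim_real_sequentially]) auto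
      moreover have "(step_mean + x * sqrt step_var * (1 / sqrt (real n))) * real n = y n" for n
      proof -
        have "1 / sqrt (real n) * real n = sqrt (real n)"
          using real_div_sqrt[of "real n"] by simp
        then show ?thesis
          by (simp only: y_def real_sqrt_mult distrib_right mult.assoc) (simp add: mult.commute)
      qed
      ultimately show ?thesis by simp
    qed
    then have "\<forall>\<^sub>F n in sequentially. 0 \<le> y n"
      by (auto simp: filterlim_at_top)
    then show ?thesis
      using eventually_gt_at_top[of 0]
    proof eventually_elim
      case (elim n)
      then have "0 < sqrt step_var * sqrt (real n)"
        using step_var_pos by simp
      then have "(real_of_int h - step_mean * real n) / (sqrt step_var * sqrt (real n)) \<le> x \<longleftrightarrow> real_of_int h \<le> y n" for h
        using divide_le_eq[of "real_of_int h - step_mean * real n" "sqrt step_var * sqrt (real n)" x]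
        by (simp add: y_def real_sqrt_mult mult.commute diff_le_eq add.commute)
      then show ?case
        using height_le[OF elim(1) k_def[of n]] by simp
    qed
  qed
  ultimately have "(\<lambda>n. LINT \<omega>|W n. of_bool ((real_of_int (height \<omega>) - step_mean * real n) / (sqrt step_var * sqrt (real n)) \<le> x))
      \<longlonglongrightarrow> cdf std_normal_distribution x - 0"
    by (rule Lim_transform_eventually)
  then show "(\<lambda>n. LINT \<omega>|W n. of_bool ((real_of_int (height \<omega>) - step_mean * real n) / (sqrt step_var * sqrt (real n)) \<le> x))
      \<longlonglongrightarrow> cdf std_normal_distribution x"
    by simp
qed

end

section \<open>Derivatives of the jump polynomial and the limit theorem\<close>

lemma deriv_jump_poly: "u \<noteq> 0 \<Longrightarrow> deriv (jump_poly p) u = p 1 - p (-1) / u\<^sup>2"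
proof (rule DERIV_imp_deriv)
  assume "u \<noteq> 0"
  then show "(jump_poly p has_field_derivative p 1 - p (-1) / u\<^sup>2) (at u)"
    unfolding jump_poly_def[abs_def]
    by (auto intro!: derivative_eq_intros simp: power2_eq_square divide_inverse)
qed

lemma drift_eq: "drift p = p 1 - p (-1)"
  by (simp add: drift_def deriv_jump_poly)

lemma deriv2_jump_poly_1: "deriv (deriv (jump_poly p)) 1 = 2 * p (-1)"
proof -
  have "deriv (deriv (jump_poly p)) 1 = deriv (\<lambda>u. p 1 - p (-1) / u\<^sup>2) 1"
  proof (rule deriv_cong_ev)
    have "\<forall>\<^sub>F u in nhds 1. u \<noteq> (0 :: real)"
      by (rule t1_space_nhds) simp
    then show "\<forall>\<^sub>F u in nhds 1. deriv (jump_poly p) u = p 1 - p (-1) / u\<^sup>2"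
      by eventually_elim (rule deriv_jump_poly)
  qed simp
  also have "\<dots> = 2 * p (-1)"
    by (rule DERIV_imp_deriv) (auto intro!: derivative_eq_intros)
  finally show ?thesis .
qed

theorem theorem4p11:
  fixes p :: "int \<Rightarrow> real"
  assumes "p (-1) > 0" and "p 0 > 0" and "p 1 > 0"
  shows
    "(drift p < 0 \<longrightarrow>
        weak_conv_m
          (\<lambda>n. distr (walk_measure p n) borel (\<lambda>\<omega>. real_of_int (height \<omega>)))
          (geometric_distribution (1 - p 1 / p (-1)))) \<and>
     (drift p = 0 \<longrightarrow>
        weak_conv_m
          (\<lambda>n. distr (walk_measure p n) borel (\<lambda>\<omega>. real_of_int (height \<omega>) / sqrt (real n)))
          (half_normal_distribution (sqrt (deriv (deriv (jump_poly p)) 1 / jump_poly p 1)))) \<and>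
     (drift p > 0 \<longrightarrow>
        (let \<mu> = drift p / jump_poly p 1;
             \<sigma> = sqrt (1 - p 0 / jump_poly p 1 - (drift p / jump_poly p 1)\<^sup>2)
         in weak_conv_m
              (\<lambda>n. distr (walk_measure p n) borel
                 (\<lambda>\<omega>. (real_of_int (height \<omega>) - \<mu> * real n) / (\<sigma> * sqrt (real n))))
              std_normal_distribution))"
proof -
  interpret motzkin_weights p
    using assms by unfold_locales
  have step_mean: "drift p / jump_poly p 1 = step_mean"
    by (simp add: drift_eq step_mean_def step_prob_def diff_divide_distrib)
  have "step_prob 1 + step_prob (-1) = 1 - step_prob 0"
    using step_prob_sum by simp
  then have step_var: "1 - p 0 / jump_poly p 1 - step_mean\<^sup>2 = step_var"
    by (simp add: step_var_def step_prob_def)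
  show ?thesis
    unfolding Let_def step_mean step_var
  proof (intro conjI impI)
    assume "drift p < 0"
    then have "r < 1"
      using pos by (simp add: drift_eq r_def)
    then show "weak_conv_m (\<lambda>n. distr (W n) borel (\<lambda>\<omega>. real_of_int (height \<omega>)))
        (geometric_distribution (1 - p 1 / p (-1)))"
      using height_negative_drift by (simp add: r_def)
  next
    assume "drift p = 0"
    then have eq: "p 1 = p (-1)"
      by (simp add: drift_eq)
    then have "r = 1"
      using pos by (simp add: r_def)
    moreover have "deriv (deriv (jump_poly p)) 1 / jump_poly p 1 = step_var"
      unfolding deriv2_jump_poly_1 by (simp add: step_var_def step_mean_def step_prob_def eq)
    ultimately show "weak_conv_m (\<lambda>n. distr (W n) borel (\<lambda>\<omega>. real_of_int (height \<omega>) / sqrt (real n)))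
        (half_normal_distribution (sqrt (deriv (deriv (jump_poly p)) 1 / jump_poly p 1)))"
      using height_zero_drift by simp
  next
    assume "0 < drift p"
    then have "1 < r"
      using pos by (simp add: drift_eq r_def)
    then show "weak_conv_m
        (\<lambda>n. distr (W n) borel (\<lambda>\<omega>. (real_of_int (height \<omega>) - step_mean * real n) / (sqrt step_var * sqrt (real n))))
        std_normal_distribution"
      by (rule height_positive_drift)
  qed
qed

end
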